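(* Let $m$ be a positive integer with $m\equiv 2\pmod 4$, let $h=\frac{m}{2}$, and let $e=3^{h}+2$. Then $\mathcal{C}_{(2,e)}$ is an optimal (ternary) cyclic code with parameters $[3^m-1,\ 3^m-2m-1,\ 4]$.
   Context: Let $m$ be a positive integer, $\mathbb{F}_{3^m}$ the finite field with $3^m$ elements, and $\alpha$ a generator of the multiplicative group $\mathbb{F}_{3^m}^*$. For an integer $i$, $m_{\alpha^i}(x)$ denotes the minimal polynomial of $\alpha^i$ over $\mathbb{F}_3$. An $[n,k,d]$ linear code over $\mathbb{F}_3$ is a $k$-dimensional subspace of $\mathbb{F}_3^n$ with minimum Hamming distance $d$. A ternary cyclic code of length $n$ (with $\gcd(n,3)=1$) is identified with an ideal of $\mathbb{F}_3[x]/(x^n-1)$ via $(c_0,\dots,c_{n-1})\mapsto c_0+c_1x+\cdots+c_{n-1}x^{n-1}$; its generator polynomial is the monic polynomial of least degree generating the ideal. $\mathcal{C}_{(i_1,i_2,\dots,i_t)}$ denotes the ternary cyclic code of length $3^m-1$ with generator polynomial $m_{\alpha^{i_1}}(x)m_{\alpha^{i_2}}(x)\cdots m_{\alpha^{i_t}}(x)$. A ternary $[n,k,d]$ code is optimal (in the standard sense) if no linear code over $\mathbb{F}_3$ of length $n$ and dimension $k$ has minimum distance larger than $d$. *)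

theory Defs
  imports
    "Berlekamp_Zassenhaus.Finite_Field"
    "Jordan_Normal_Form.VS_Connect"
    "HOL-Number_Theory.Cong"
begin

(* The index type of mod_ring only contributes its cardinality. *)
typedef three = "{0..<3::nat}"
  by (rule exI[of _ 0]) simp

lemma card_three: "CARD(three) = 3"
  using type_definition.card[OF type_definition_three] by simp

instance three :: prime_card
  by standard (simp add: card_three)

type_synonym F3 = "three mod_ring"

(* A ring homomorphism exactly when the target has characteristic 3. *)
definition embed_F3 :: "F3 \<Rightarrow> 'f::field" where
  "embed_F3 c = of_int (to_int_mod_ring c)"

definition is_min_poly_F3 :: "'f::field \<Rightarrow> F3 poly \<Rightarrow> bool" where
  "is_min_poly_F3 \<beta> p \<longleftrightarrow>
     monic p \<and> poly (map_poly embed_F3 p) \<beta> = 0 \<and>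
     (\<forall>q. q \<noteq> 0 \<and> poly (map_poly embed_F3 q) \<beta> = 0 \<longrightarrow> degree p \<le> degree q)"

definition min_poly_F3 :: "'f::field \<Rightarrow> F3 poly" where
  "min_poly_F3 \<beta> = (THE p. is_min_poly_F3 \<beta> p)"

definition generates_units :: "'f::field \<Rightarrow> bool" where
  "generates_units \<alpha> \<longleftrightarrow> range (\<lambda>k::nat. \<alpha> ^ k) = - {0}"


definition linear_subspace :: "nat \<Rightarrow> 'a::field vec set \<Rightarrow> bool" where
  "linear_subspace n C \<longleftrightarrow> VectorSpace.subspace class_ring C (module_vec TYPE('a) n)"

definition code_dim :: "nat \<Rightarrow> 'a::field vec set \<Rightarrow> nat" where
  "code_dim n C = vectorspace.dim class_ring ((module_vec TYPE('a) n)\<lparr>carrier := C\<rparr>)"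

definition hamming_dist :: "'a vec \<Rightarrow> 'a vec \<Rightarrow> nat" where
  "hamming_dist x y = card {i. i < dim_vec x \<and> x $ i \<noteq> y $ i}"

(* Equals 0 on codes with at most one word, since Inf {} = 0 on nat. *)
definition min_dist :: "'a vec set \<Rightarrow> nat" where
  "min_dist C = Inf {hamming_dist x y | x y. x \<in> C \<and> y \<in> C \<and> x \<noteq> y}"

definition linear_code :: "nat \<Rightarrow> nat \<Rightarrow> nat \<Rightarrow> 'a::field vec set \<Rightarrow> bool" where
  "linear_code n k d C \<longleftrightarrow> linear_subspace n C \<and> code_dim n C = k \<and> min_dist C = d"

definition optimal_code :: "nat \<Rightarrow> nat \<Rightarrow> nat \<Rightarrow> 'a::field vec set \<Rightarrow> bool" where
  "optimal_code n k d C \<longleftrightarrow>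
     linear_code n k d C \<and> \<not> (\<exists>(C' :: 'a vec set) d'. linear_code n k d' C' \<and> d < d')"


definition cyclic_shift :: "'a vec \<Rightarrow> 'a vec" where
  "cyclic_shift c = vec (dim_vec c) (\<lambda>i. if i = 0 then c $ (dim_vec c - 1) else c $ (i - 1))"

definition cyclic_code :: "nat \<Rightarrow> 'a::field vec set \<Rightarrow> bool" where
  "cyclic_code n C \<longleftrightarrow> linear_subspace n C \<and> (\<forall>c\<in>C. cyclic_shift c \<in> C)"

definition code_poly :: "'a::zero vec \<Rightarrow> 'a poly" where
  "code_poly c = Poly (list_of_vec c)"

(* The ideal of F[x]/(x^n - 1) generated by the class of g, read back as a set of words. *)
definition ideal_code :: "nat \<Rightarrow> 'a::field_gcd poly \<Rightarrow> 'a vec set" where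
  "ideal_code n g =
     {c \<in> carrier_vec n. \<exists>q. [code_poly c = q * g] (mod (monom 1 n - 1))}"

definition generator_poly :: "nat \<Rightarrow> 'a::field_gcd vec set \<Rightarrow> 'a poly \<Rightarrow> bool" where
  "generator_poly n C g \<longleftrightarrow>
     monic g \<and> ideal_code n g = C \<and>
     (\<forall>g'. monic g' \<and> ideal_code n g' = C \<longrightarrow> degree g \<le> degree g')"

definition min_poly_product :: "'f::field \<Rightarrow> int list \<Rightarrow> F3 poly" where
  "min_poly_product \<alpha> is = (\<Prod>i\<leftarrow>is. min_poly_F3 (\<alpha> powi i))"

(* The code generated by the product; that the product is its generator polynomial
   in the sense of generator_poly is a separate claim. *)
definition ternary_cyclic_code :: "nat \<Rightarrow> 'f::field \<Rightarrow> int list \<Rightarrow> F3 vec set" where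
  "ternary_cyclic_code m \<alpha> is = ideal_code (3 ^ m - 1) (min_poly_product \<alpha> is)"

end

theory Submission
  imports Defs "Berlekamp_Zassenhaus.Berlekamp_Type_Based"
begin

text \<open>
  Write \<open>\<sigma> x = x ^ (3 ^ h)\<close>, an involutive automorphism of the field with \<open>3 ^ m\<close> elements, so that
  \<open>x ^ e = \<sigma> x * x\<^sup>2\<close>. A word of weight at most three in the code gives a relation
  \<open>\<plusminus>x\<^sup>2 \<plusminus> y\<^sup>2 \<plusminus> z\<^sup>2 = 0\<close> that persists when each square \<open>u\<^sup>2\<close> is replaced by \<open>\<sigma> u * u\<^sup>2\<close>. Combined with
  its conjugate under \<open>\<sigma>\<close>, it forces two of the elements to coincide; for equal signs this uses that
  \<open>-1\<close> is not a square in the fixed field of \<open>\<sigma>\<close>, as \<open>h\<close> is odd. The two minimal polynomials are distinct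
  of degree \<open>m\<close>, which gives the dimension, and a code with these parameters and distance at least
  five violates the sphere packing bound, since \<open>2 * n * (n - 1) > (n + 1)\<^sup>2\<close>.
\<close>

section \<open>Relations between squares under an involution in characteristic 3\<close>

text \<open>Collects what the argument needs from a Frobenius power of order two, free of exponents.
  \<open>no_fixed_sqrt\<close> says that -1 is not a square in the fixed field of
  \<open>\<sigma>\<close>.\<close>

locale involution_char3 =
  fixes \<sigma> :: "'a::field \<Rightarrow> 'a"
  assumes three: "(3::'a) = 0"
    and sigma_add: "\<sigma> (x + y) = \<sigma> x + \<sigma> y"
    and sigma_mult: "\<sigma> (x * y) = \<sigma> x * \<sigma> y"
    and sigma_sigma: "\<sigma> (\<sigma> x) = x"
    and no_fixed_sqrt: "w ^ 2 = -1 \<Longrightarrow> \<sigma> w \<noteq> w"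
begin

lemma sigma_0: "\<sigma> 0 = 0"
  using sigma_add[of 0 0] by (metis add_0 add_left_cancel add.right_neutral)

lemma sigma_1: "\<sigma> 1 = 1"
proof -
  have "\<sigma> 1 * \<sigma> 1 = \<sigma> 1" using sigma_mult[of 1 1] by simp
  moreover have "\<sigma> 1 \<noteq> 0" using sigma_sigma[of 1] sigma_0 by auto
  ultimately show ?thesis by simp
qed

lemma sigma_minus: "\<sigma> (- x) = - \<sigma> x"
  using sigma_add[of x "- x"] sigma_0 by (simp add: eq_neg_iff_add_eq_0 add.commute)

lemma sigma_power: "\<sigma> (x ^ k) = \<sigma> x ^ k"
  by (induction k) (simp_all add: sigma_1 sigma_mult)

lemma sigma_diff: "\<sigma> (x - y) = \<sigma> x - \<sigma> y"
  using sigma_add[of x "- y"] sigma_minus[of y] by simp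

lemma sigma_divide: "\<sigma> (x / y) = \<sigma> x / \<sigma> y"
proof (cases "y = 0")
  case True then show ?thesis by (simp add: sigma_0)
next
  case False
  then have "\<sigma> y \<noteq> 0" using sigma_sigma[of y] sigma_0 by auto
  then show ?thesis using sigma_mult[of "x / y" y] False by (simp add: field_simps)
qed

lemma neg_self_zero: "x = - x \<Longrightarrow> x = (0::'a)"
proof -
  assume "x = - x"
  then have "x + x = 0" by (simp add: eq_neg_iff_add_eq_0)
  moreover have "x = 3 * x - (x + x)" by (simp add: algebra_simps)
  ultimately show "x = 0" using three by (metis diff_self mult_zero_left)
qed

text \<open>
  With \<open>t = \<sigma> y\<close>, eliminating \<open>z\<close> and \<open>\<sigma> z\<close> leaves one relation between \<open>y\<close> and \<open>t\<close> together with
  its image under \<open>\<sigma>\<close>. Their difference (divided by \<open>y - t\<close>) and their sum are polynomials in the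
  trace \<open>T\<close> and the norm \<open>N\<close>, which \<open>\<sigma>\<close> fixes. All these polynomial identities hold only modulo 3;
  the summands \<open>3 * \<dots>\<close> are the exact corrections over the integers.
\<close>

lemma sum_squares_zero_normalised:
  assumes sq: "1 + y\<^sup>2 + z\<^sup>2 = 0" and e: "1 + \<sigma> y * y\<^sup>2 + \<sigma> z * z\<^sup>2 = 0"
  shows "y = 1"
proof -
  define t where "t = \<sigma> y"
  have st: "\<sigma> t = y" by (simp add: t_def sigma_sigma)
  have sq': "1 + t\<^sup>2 + (\<sigma> z)\<^sup>2 = 0"
    using arg_cong[OF sq, of \<sigma>] by (simp add: sigma_0 sigma_1 sigma_add sigma_power t_def)
  have "\<sigma> z * z\<^sup>2 = - (1 + t * y\<^sup>2)"
    using e unfolding t_def by (metis add.commute add_eq_0_iff)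
  moreover have "z\<^sup>2 = - (1 + y\<^sup>2)" "(\<sigma> z)\<^sup>2 = - (1 + t\<^sup>2)"
    using sq sq' by (metis add_eq_0_iff)+
  \<comment> \<open>Squaring removes \<open>z\<close>: in \<open>(\<sigma> z)^2 * (z^2)^2\<close>
    both factors are already known in terms of \<open>y\<close> and \<open>t\<close>.\<close>
  ultimately have "(- (1 + t * y\<^sup>2))\<^sup>2 = - (1 + t\<^sup>2) * (- (1 + y\<^sup>2))\<^sup>2"
    by (metis power_mult_distrib)
  then have e1: "- (1 + t\<^sup>2) * (1 + y\<^sup>2)\<^sup>2 = (1 + t * y\<^sup>2)\<^sup>2"
    by (simp only: power2_minus)
  have e2: "- (1 + y\<^sup>2) * (1 + t\<^sup>2)\<^sup>2 = (1 + y * t\<^sup>2)\<^sup>2"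
    using arg_cong[OF e1, of \<sigma>]
    by (simp add: sigma_1 sigma_add sigma_mult sigma_minus sigma_diff sigma_power st flip: t_def)
  show ?thesis
  proof (cases "t = y")
    case True
    \<comment> \<open>For \<open>t = y\<close> the relation \<open>e1\<close> involves
      \<open>y\<close> alone and, modulo 3, collapses to
      \<open>(1 - y^3)^2 = (1 - y)^6\<close>.\<close>
    have "(y - 1) ^ 6 = (- (1 + y\<^sup>2) * (1 + y\<^sup>2)\<^sup>2 - (1 + y * y\<^sup>2)\<^sup>2)
        + 3 * (1 - 2*y + 6*y^2 - 6*y^3 + 6*y^4 - 2*y^5 + y^6)" by Groebner_Basis.algebra
    then have "(y - 1) ^ 6 = 0" using e1 three True by simp
    then show ?thesis by simp
  next
    case False
    define T N where "T = y + t" and "N = y * t"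
    have fixT: "\<sigma> T = T" and fixN: "\<sigma> N = N"
      by (simp_all add: T_def N_def sigma_add sigma_mult st add.commute mult.commute flip: t_def)
    have "(y - t) * (T^3 + T * (- N\<^sup>2 + N + 1) - N) =
        - ((- (1 + t\<^sup>2) * (1 + y\<^sup>2)\<^sup>2 - (1 + t * y\<^sup>2)\<^sup>2) - (- (1 + y\<^sup>2) * (1 + t\<^sup>2)\<^sup>2 - (1 + y * t\<^sup>2)\<^sup>2))
        + 3 * (-(y^4)*t^2 + y^3*t - y^2*t + y^2*t^4 + y*t^2 - y*t^3)"
      unfolding T_def N_def by Groebner_Basis.algebra
    then have D: "T^3 + T * (- N\<^sup>2 + N + 1) - N = 0"
      using e1 e2 three False by simp
    have "T^4 - T\<^sup>2 * (N\<^sup>2 + N) - N * T - N^3 + 1 =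
        - ((- (1 + t\<^sup>2) * (1 + y\<^sup>2)\<^sup>2 - (1 + t * y\<^sup>2)\<^sup>2) + (- (1 + y\<^sup>2) * (1 + t\<^sup>2)\<^sup>2 - (1 + y * t\<^sup>2)\<^sup>2))
        + 3 * (- 1 - y^2 - y^4*t^2 + y^3*t - y^3*t^3 - y^2*t - y^2*t^4 - y*t^2 + y*t^3 - t^2)"
      unfolding T_def N_def by Groebner_Basis.algebra
    then have S: "T^4 - T\<^sup>2 * (N\<^sup>2 + N) - N * T - N^3 + 1 = 0"
      using e1 e2 three by simp
    \<comment> \<open>Eliminating \<open>T^4\<close> between \<open>D\<close> and \<open>S\<close>
      leaves \<open>(N - 1) * ((N - 1)^2 - T^2)\<close>, a product of linear factors; each case
      turns \<open>D\<close> into a polynomial in one variable.\<close>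
    have "(N - 1) * ((N - 1 - T) * (N - 1 + T)) =
        - (T^4 - T\<^sup>2 * (N\<^sup>2 + N) - N * T - N^3 + 1) + T * (T^3 + T * (- N\<^sup>2 + N + 1) - N)
        + 3 * (N - N\<^sup>2 - N * T\<^sup>2)"
      by Groebner_Basis.algebra
    then have "(N - 1) * ((N - 1 - T) * (N - 1 + T)) = 0"
      using D S three by simp
    then consider "N - 1 = 0" | "N - 1 - T = 0" | "N - 1 + T = 0"
      by (metis mult_eq_0_iff)
    then consider "N = 1" | "T = N - 1" | "T = 1 - N"
      by cases (simp_all add: algebra_simps)
    then show ?thesis
    proof cases
      case 1
      have "(T + 1) * ((T + 1)\<^sup>2 + 1) = (T^3 + T - 1) + 3 * (1 + T + T\<^sup>2)"
        by Groebner_Basis.algebra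
      then have "(T + 1) * ((T + 1)\<^sup>2 + 1) = 0" using D three 1 by simp
      moreover have "(T + 1)\<^sup>2 + 1 \<noteq> 0"
        using no_fixed_sqrt[of "T + 1"] fixT sigma_add sigma_1 by (auto simp: eq_neg_iff_add_eq_0)
      ultimately have "T + 1 = 0" by simp
      \<comment> \<open>Trace -1 and norm 1 make \<open>y\<close> a root of
        \<open>X^2 + X + 1\<close>, which is \<open>(X - 1)^2\<close> modulo 3.\<close>
      moreover have "(y - 1)\<^sup>2 = y * (T + 1) + (1 - N) - 3 * y"
        unfolding T_def N_def by Groebner_Basis.algebra
      ultimately have "(y - 1)\<^sup>2 = 0" using three 1 by simp
      then show ?thesis by simp
    next
      case 2
      \<comment> \<open>This case and the next are contradictory: \<open>D\<close> exhibits -1 as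
        the square of an element fixed by \<open>\<sigma>\<close>.\<close>
      have "(N - 1)\<^sup>2 + 1 = 0"
        using D 2 by Groebner_Basis.algebra
      moreover have "(N - 1)\<^sup>2 + 1 \<noteq> 0"
        using no_fixed_sqrt[of "N - 1"] fixN sigma_diff sigma_1 by (auto simp: eq_neg_iff_add_eq_0)
      ultimately show ?thesis by simp
    next
      case 3
      have "(N + 1)\<^sup>2 + 1 = ((1 - N)^3 + (1 - N) * (- N\<^sup>2 + N + 1) - N) + 3 * (2 * N)"
        by Groebner_Basis.algebra
      then have "(N + 1)\<^sup>2 + 1 = 0" using D 3 three by simp
      moreover have "(N + 1)\<^sup>2 + 1 \<noteq> 0"
        using no_fixed_sqrt[of "N + 1"] fixN sigma_add sigma_1 by (auto simp: eq_neg_iff_add_eq_0)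
      ultimately show ?thesis by simp
    qed
  qed
qed

text \<open>
  Here the relations between \<open>T\<close> and \<open>N\<close> have other solutions, but they make
  \<open>N * (y - t)\<close> equal to \<open>\<plusminus> T * (N - 1)\<close>, whereas \<open>\<sigma>\<close> negates the former and fixes the latter.
\<close>

lemma sum_squares_one:
  assumes sq: "y\<^sup>2 + z\<^sup>2 = 1" and e: "\<sigma> y * y\<^sup>2 + \<sigma> z * z\<^sup>2 = 1"
  shows "y = 0 \<or> y = 1"
proof -
  define t where "t = \<sigma> y"
  have st: "\<sigma> t = y" by (simp add: t_def sigma_sigma)
  have sq': "t\<^sup>2 + (\<sigma> z)\<^sup>2 = 1"
    using arg_cong[OF sq, of \<sigma>] by (simp add: sigma_0 sigma_1 sigma_add sigma_power t_def)
  have "\<sigma> z * z\<^sup>2 = 1 - t * y\<^sup>2"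
    using e by (simp add: t_def eq_diff_eq add_ac)
  moreover have "z\<^sup>2 = 1 - y\<^sup>2" "(\<sigma> z)\<^sup>2 = 1 - t\<^sup>2"
    using sq sq' by (simp_all add: eq_diff_eq add_ac)
  ultimately have e1: "(1 - t\<^sup>2) * (1 - y\<^sup>2)\<^sup>2 = (1 - t * y\<^sup>2)\<^sup>2"
    by (metis power_mult_distrib)
  have e2: "(1 - y\<^sup>2) * (1 - t\<^sup>2)\<^sup>2 = (1 - y * t\<^sup>2)\<^sup>2"
    using arg_cong[OF e1, of \<sigma>]
    by (simp add: sigma_1 sigma_add sigma_mult sigma_minus sigma_diff sigma_power st flip: t_def)
  show ?thesis
  proof (cases "t = y")
    case True
    \<comment> \<open>For \<open>t = y\<close> the relation \<open>e1\<close> reduces modulo 3 to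
      \<open>y^3 * (1 - y^3) = 0\<close>, a perfect cube.\<close>
    have "(y * (1 - y)) ^ 3 = - ((1 - y\<^sup>2) * (1 - y\<^sup>2)\<^sup>2 - (1 - y * y\<^sup>2)\<^sup>2)
        + 3 * (y^3 - y^2 + y^5 - y^6)" by Groebner_Basis.algebra
    then have "(y * (1 - y)) ^ 3 = 0" using e1 three True by simp
    then show ?thesis by simp
  next
    case False
    define T N where "T = y + t" and "N = y * t"
    have fixT: "\<sigma> T = T" and fixN: "\<sigma> N = N"
      by (simp_all add: T_def N_def sigma_add sigma_mult st add.commute mult.commute flip: t_def)
    have "(y - t) * (T^3 + T * (N\<^sup>2 + N - 1) - N) =
        ((1 - t\<^sup>2) * (1 - y\<^sup>2)\<^sup>2 - (1 - t * y\<^sup>2)\<^sup>2) - ((1 - y\<^sup>2) * (1 - t\<^sup>2)\<^sup>2 - (1 - y * t\<^sup>2)\<^sup>2)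
        + 3 * (y^4*t^2 + y^3*t - y^2*t - y^2*t^4 + y*t^2 - y*t^3)"
      unfolding T_def N_def by Groebner_Basis.algebra
    then have D: "T^3 + T * (N\<^sup>2 + N - 1) - N = 0"
      using e1 e2 three False by simp
    have "T^4 + T\<^sup>2 * (N\<^sup>2 - N) + N^3 - N * T =
        ((1 - t\<^sup>2) * (1 - y\<^sup>2)\<^sup>2 - (1 - t * y\<^sup>2)\<^sup>2) + ((1 - y\<^sup>2) * (1 - t\<^sup>2)\<^sup>2 - (1 - y * t\<^sup>2)\<^sup>2)
        + 3 * (y^2 + y^4*t^2 + y^3*t + y^3*t^3 - y^2*t + y^2*t^4 - y*t^2 + y*t^3 + t^2)"
      unfolding T_def N_def by Groebner_Basis.algebra
    then have S: "T^4 + T\<^sup>2 * (N\<^sup>2 - N) + N^3 - N * T = 0"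
      using e1 e2 three by simp
    have "T\<^sup>2 * (N + 1) + N^3 =
        (T^4 + T\<^sup>2 * (N\<^sup>2 - N) + N^3 - N * T) - T * (T^3 + T * (N\<^sup>2 + N - 1) - N) + 3 * (N * T\<^sup>2)"
      by Groebner_Basis.algebra
    then have R: "T\<^sup>2 * (N + 1) + N^3 = 0"
      using D S three by simp
    \<comment> \<open>Modulo 3, \<open>(y - t)^2 = T^2 - 4 * N = T^2 - N\<close>, which turns the
      left side of \<open>R\<close>, up to sign, into a difference of two squares.\<close>
    have "(N * (y - t) - T * (N - 1)) * (N * (y - t) + T * (N - 1)) = - (T\<^sup>2 * (N + 1) + N^3)
        + 3 * (y^3*t - y^3*t^3 + 2*y^2*t^2 + y*t^3)"
      unfolding T_def N_def by Groebner_Basis.algebra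
    then have "(N * (y - t) - T * (N - 1)) * (N * (y - t) + T * (N - 1)) = 0"
      using R three by simp
    then obtain c where c: "N * (y - t) = c" "\<sigma> c = c"
    proof -
      consider "N * (y - t) = T * (N - 1)" | "N * (y - t) = - (T * (N - 1))"
        using \<open>_ * _ = 0\<close> by (auto simp: eq_neg_iff_add_eq_0)
      then show thesis
        using that by cases (simp_all add: sigma_mult sigma_minus sigma_diff sigma_1 fixT fixN)
    qed
    moreover have "\<sigma> (N * (y - t)) = N * (t - y)"
      by (simp add: sigma_mult sigma_diff fixN st flip: t_def)
    ultimately have "N * (y - t) = N * (t - y)" by simp
    also have "\<dots> = - (N * (y - t))" by Groebner_Basis.algebra
    finally have "N * (y - t) = 0" by (rule neg_self_zero)
    then have "N = 0" using False by simp
    then show ?thesis using st sigma_0 by (auto simp: N_def)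
  qed
qed

text \<open>By homogeneity: divide the two relations by \<open>x^2\<close> and
  \<open>\<sigma> x * x^2\<close>, \<open>\<sigma>\<close> being multiplicative.\<close>

lemma sum_squares_zero:
  assumes "x\<^sup>2 + y\<^sup>2 + z\<^sup>2 = 0" "\<sigma> x * x\<^sup>2 + \<sigma> y * y\<^sup>2 + \<sigma> z * z\<^sup>2 = 0" "x \<noteq> 0"
  shows "y = x"
proof -
  have sx: "\<sigma> x \<noteq> 0" using assms(3) sigma_sigma[of x] sigma_0 by auto
  have "1 + (y/x)\<^sup>2 + (z/x)\<^sup>2 = (x\<^sup>2 + y\<^sup>2 + z\<^sup>2) / x\<^sup>2"
    using assms(3) by (simp add: field_simps)
  moreover have "1 + \<sigma> (y/x) * (y/x)\<^sup>2 + \<sigma> (z/x) * (z/x)\<^sup>2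
      = (\<sigma> x * x\<^sup>2 + \<sigma> y * y\<^sup>2 + \<sigma> z * z\<^sup>2) / (\<sigma> x * x\<^sup>2)"
    using assms(3) sx by (simp add: field_simps sigma_divide)
  ultimately have "y / x = 1"
    using assms by (intro sum_squares_zero_normalised) simp_all
  then show ?thesis using assms(3) by simp
qed

lemma sum_squares_square:
  assumes "y\<^sup>2 + z\<^sup>2 = x\<^sup>2" "\<sigma> y * y\<^sup>2 + \<sigma> z * z\<^sup>2 = \<sigma> x * x\<^sup>2" "x \<noteq> 0"
  shows "y = 0 \<or> y = x"
proof -
  have sx: "\<sigma> x \<noteq> 0" using assms(3) sigma_sigma[of x] sigma_0 by auto
  have "(y/x)\<^sup>2 + (z/x)\<^sup>2 = (y\<^sup>2 + z\<^sup>2) / x\<^sup>2"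
    using assms(3) by (simp add: field_simps)
  moreover have "\<sigma> (y/x) * (y/x)\<^sup>2 + \<sigma> (z/x) * (z/x)\<^sup>2
      = (\<sigma> y * y\<^sup>2 + \<sigma> z * z\<^sup>2) / (\<sigma> x * x\<^sup>2)"
    using assms(3) sx by (simp add: field_simps sigma_divide)
  ultimately have "y / x = 0 \<or> y / x = 1"
    using assms sx by (intro sum_squares_one) simp_all
  then show ?thesis using assms(3) by auto
qed

text \<open>Subtracting \<open>\<sigma> y\<close> times the first relation from the second leaves
  \<open>a * x^2 * (\<sigma> x - \<sigma> y) = 0\<close>, and \<open>\<sigma>\<close> is
  injective.\<close>

lemma two_term_relation:
  assumes "a \<noteq> 0" "x \<noteq> 0" "a * x\<^sup>2 + b * y\<^sup>2 = 0" "a * (\<sigma> x * x\<^sup>2) + b * (\<sigma> y * y\<^sup>2) = 0"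
  shows "x = y"
proof -
  have "a * x\<^sup>2 = - (b * y\<^sup>2)" using assms(3) by (simp add: eq_neg_iff_add_eq_0)
  moreover have "\<sigma> x * (a * x\<^sup>2) + \<sigma> y * (b * y\<^sup>2) = 0" using assms(4) by (simp add: ac_simps)
  ultimately have "(a * x\<^sup>2) * (\<sigma> x - \<sigma> y) = 0" by (simp add: algebra_simps)
  then have "\<sigma> x = \<sigma> y" using assms(1,2) by simp
  then show ?thesis using sigma_sigma by metis
qed

text \<open>Three signs either all agree, which is \<open>sum_squares_zero\<close>, or exactly one
  differs; its term then moves to the other side and \<open>sum_squares_square\<close>
  applies.\<close>

lemma three_term_relation:
  assumes "a \<in> {1,-1}" "b \<in> {1,-1}" "c \<in> {1,-1}" "x \<noteq> 0" "y \<noteq> 0" "z \<noteq> 0"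
    and "a * x\<^sup>2 + b * y\<^sup>2 + c * z\<^sup>2 = 0"
    and "a * (\<sigma> x * x\<^sup>2) + b * (\<sigma> y * y\<^sup>2) + c * (\<sigma> z * z\<^sup>2) = 0"
  shows "x = y \<or> y = z \<or> x = z"
proof -
  consider "b = a" "c = a" | "b = a" "c = -a" | "b = -a" "c = a" | "a = -b" "c = b"
    using assms(1-3) by auto
  moreover have distrib: "k * (u + v + w) = k * u + k * v + k * w"
      "k * (u + v - w) = k * u + k * v + - k * w" for k u v w :: 'a
    by (simp_all add: distrib_left right_diff_distrib)
  ultimately show ?thesis
  proof cases
    case 1
    have "a * (x\<^sup>2 + y\<^sup>2 + z\<^sup>2) = 0" "a * (\<sigma> x * x\<^sup>2 + \<sigma> y * y\<^sup>2 + \<sigma> z * z\<^sup>2) = 0"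
      using assms(7,8) unfolding 1 distrib by (simp_all only: add_ac)
    then have "y = x" using assms(1,4) by (intro sum_squares_zero[of x y z]) auto
    then show ?thesis by simp
  next
    case 2
    have "a * (x\<^sup>2 + y\<^sup>2 - z\<^sup>2) = 0" "a * (\<sigma> x * x\<^sup>2 + \<sigma> y * y\<^sup>2 - \<sigma> z * z\<^sup>2) = 0"
      using assms(7,8) unfolding 2 distrib by (simp_all only: add_ac)
    then have "x = 0 \<or> x = z" using assms(1,4-6) by (intro sum_squares_square[of x y z]) auto
    then show ?thesis using assms(4-6) by auto
  next
    case 3
    have "a * (x\<^sup>2 + z\<^sup>2 - y\<^sup>2) = 0" "a * (\<sigma> x * x\<^sup>2 + \<sigma> z * z\<^sup>2 - \<sigma> y * y\<^sup>2) = 0"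
      using assms(7,8) unfolding 3 distrib by (simp_all only: add_ac)
    then have "x = 0 \<or> x = y" using assms(1,4-6) by (intro sum_squares_square[of x z y]) auto
    then show ?thesis using assms(4-6) by auto
  next
    case 4
    have "b * (y\<^sup>2 + z\<^sup>2 - x\<^sup>2) = 0" "b * (\<sigma> y * y\<^sup>2 + \<sigma> z * z\<^sup>2 - \<sigma> x * x\<^sup>2) = 0"
      using assms(7,8) unfolding 4 distrib by (simp_all only: add_ac)
    then have "y = 0 \<or> y = x" using assms(2,4-6) by (intro sum_squares_square[of y z x]) auto
    then show ?thesis using assms(4-6) by auto
  qed
qed

end

section \<open>Linear and cyclic codes\<close>

text \<open>Coordinates with respect to a basis are unique, so vectors correspond to functions from
  the basis to the scalars. Dimensions of codes can thus be found by counting words.\<close>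

lemma (in vectorspace) card_carrier_eq_power_dim:
  assumes "finite (carrier V)"
  shows "card (carrier V) = card (carrier K) ^ dim"
proof -
  have "fin_dim"
    unfolding fin_dim_def using assms span_is_subset2[of "carrier V"] in_own_span[of "carrier V"]
    by (intro exI[of _ "carrier V"]) auto
  then obtain B where B: "finite B" "basis B"
    using finite_basis_exists by blast
  then have BV: "B \<subseteq> carrier V" by (simp add: basis_def)
  have uniq: "\<exists>!a. a \<in> B \<rightarrow>\<^sub>E carrier K \<and> lincomb a B = v" if "v \<in> carrier V" for v
    using basis_criterion[OF B(1) BV] B(2) that by blast
  have "bij_betw (\<lambda>a. lincomb a B) (B \<rightarrow>\<^sub>E carrier K) (carrier V)"
    unfolding bij_betw_def
  proof
    have closed: "lincomb a B \<in> carrier V" if "a \<in> B \<rightarrow>\<^sub>E carrier K" for a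
      using that BV by (intro lincomb_closed) (auto simp: PiE_def)
    then show "inj_on (\<lambda>a. lincomb a B) (B \<rightarrow>\<^sub>E carrier K)"
      using uniq by (intro inj_onI) metis
    show "(\<lambda>a. lincomb a B) ` (B \<rightarrow>\<^sub>E carrier K) = carrier V"
      using closed uniq by blast
  qed
  then have "card (carrier V) = card (B \<rightarrow>\<^sub>E carrier K)"
    by (simp add: bij_betw_same_card)
  also have "\<dots> = card (carrier K) ^ card B"
    using B(1) by (simp add: card_PiE)
  also have "card B = dim" using dim_basis[OF B] by simp
  finally show ?thesis .
qed

lemma card_linear_code:
  fixes C :: "'a::{field,finite} vec set"
  assumes "linear_subspace n C"
  shows "card C = CARD('a) ^ code_dim n C"
proof -
  interpret vs: vec_space "TYPE('a)" n .
  have sub: "VectorSpace.subspace class_ring C vs.V"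
    using assms by (simp add: linear_subspace_def)
  interpret W: vectorspace class_ring "vs.vs C"
    by (rule vs.subspace_is_vs[OF sub])
  have "C \<subseteq> carrier_vec n"
    using sub submodule.subset unfolding subspace_def by fastforce
  then have "finite C" by (rule finite_subset) (rule finite_carrier_vec)
  then show ?thesis
    using W.card_carrier_eq_power_dim by (simp add: code_dim_def)
qed

section \<open>Words as polynomials, cyclic codes as ideals\<close>

lemma coeff_code_poly: "coeff (code_poly v) i = (if i < dim_vec v then v $ i else 0)"
  by (simp add: code_poly_def coeff_Poly_eq nth_default_def list_of_vec_index)

lemma code_poly_inj: "v \<in> carrier_vec N \<Longrightarrow> w \<in> carrier_vec N \<Longrightarrow> code_poly v = code_poly w \<Longrightarrow> v = w"
  by (metis (no_types, lifting) carrier_vecD coeff_code_poly eq_vecI)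

text \<open>The disjunct \<open>p = 0\<close> matters for length 0, since the zero polynomial has
  degree 0.\<close>

lemma code_poly_vec_coeff:
  assumes "p = 0 \<or> degree p < N"
  shows "code_poly (vec N (coeff p)) = p"
  using assms by (intro poly_eqI) (auto simp: coeff_code_poly coeff_eq_0)

lemma code_poly_degree: "code_poly v = 0 \<or> degree (code_poly v) < dim_vec v"
  by (metis coeff_code_poly leading_coeff_0_iff)

lemma code_poly_add:
  "dim_vec v = dim_vec w \<Longrightarrow> code_poly (v + w) = code_poly v + code_poly (w :: 'a::comm_ring_1 vec)"
  by (intro poly_eqI) (simp add: coeff_code_poly)

lemma code_poly_diff:
  "dim_vec v = dim_vec w \<Longrightarrow> code_poly (v - w) = code_poly v - code_poly (w :: 'a::comm_ring_1 vec)"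
  by (intro poly_eqI) (simp add: coeff_code_poly)

lemma code_poly_smult: "code_poly (c \<cdot>\<^sub>v v) = smult c (code_poly (v :: 'a::comm_ring_1 vec))"
  by (intro poly_eqI) (simp add: coeff_code_poly)

lemma code_poly_zero: "code_poly (0\<^sub>v N :: 'a::comm_ring_1 vec) = 0"
  by (intro poly_eqI) (simp add: coeff_code_poly)

lemma code_poly_as_sum: "code_poly v = (\<Sum>i<dim_vec v. monom (v $ i) i)"
  for v :: "'a::comm_ring_1 vec"
  by (intro poly_eqI) (simp add: coeff_code_poly coeff_sum)

text \<open>Shifting is multiplication by x modulo \<open>x^N - 1\<close>: the overflowing term of
  degree \<open>N\<close> returns as the constant term.\<close>

lemma code_poly_cyclic_shift:
  fixes c :: "'a::comm_ring_1 vec"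
  assumes "dim_vec c = N" "N > 0"
  shows "code_poly (cyclic_shift c) = pCons 0 (code_poly c) - smult (c $ (N - 1)) (monom 1 N - 1)"
proof (rule poly_eqI)
  fix i
  show "coeff (code_poly (cyclic_shift c)) i
      = coeff (pCons 0 (code_poly c) - smult (c $ (N - 1)) (monom 1 N - 1)) i"
  proof (cases i)
    case (Suc k)
    then show ?thesis
      using assms by (cases "i = N") (auto simp: coeff_code_poly cyclic_shift_def)
  qed (use assms in \<open>auto simp: coeff_code_poly cyclic_shift_def\<close>)
qed

lemma linear_subspaceI:
  fixes C :: "'a::field vec set"
  assumes "C \<subseteq> carrier_vec N" "0\<^sub>v N \<in> C" "\<And>v w. v \<in> C \<Longrightarrow> w \<in> C \<Longrightarrow> v + w \<in> C"
    "\<And>c v. v \<in> C \<Longrightarrow> c \<cdot>\<^sub>v v \<in> C"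
  shows "linear_subspace N C"
proof -
  interpret vs: vec_space "TYPE('a)" N .
  show ?thesis
    unfolding linear_subspace_def subspace_def submodule_def
    using assms vs.vectorspace_axioms vs.module_axioms by (auto simp: module_vec_simps)
qed

lemma linear_subspace_carrier: "linear_subspace N C \<Longrightarrow> C \<subseteq> carrier_vec N"
  by (auto simp: linear_subspace_def subspace_def submodule_def module_vec_simps)

text \<open>When \<open>g\<close> divides the modulus, a congruence modulo \<open>x^N - 1\<close> is
  also one modulo \<open>g\<close>, so the quotient ring disappears from the description.\<close>

lemma ideal_code_eq_multiples:
  assumes "g dvd monom 1 N - 1"
  shows "ideal_code N g = {c \<in> carrier_vec N. g dvd code_poly c}"
proof -
  have "(\<exists>q. [code_poly c = q * g] (mod (monom 1 N - 1))) \<longleftrightarrow> g dvd code_poly c" for c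
  proof
    assume "\<exists>q. [code_poly c = q * g] (mod (monom 1 N - 1))"
    then obtain q where "[code_poly c = q * g] (mod g)"
      using assms cong_dvd_modulus by blast
    then show "g dvd code_poly c" by (simp add: cong_dvd_iff)
  next
    assume "g dvd code_poly c"
    then show "\<exists>q. [code_poly c = q * g] (mod (monom 1 N - 1))"
      by (metis cong_refl dvd_def mult.commute)
  qed
  then show ?thesis by (simp add: ideal_code_def)
qed

lemma cyclic_code_ideal_code:
  fixes g :: "'a::field_gcd poly"
  assumes "g dvd monom 1 N - 1" "N > 0"
  shows "cyclic_code N (ideal_code N g)"
  unfolding cyclic_code_def ideal_code_eq_multiples[OF assms(1)]
proof
  show "linear_subspace N {c \<in> carrier_vec N. g dvd code_poly c}"
    by (rule linear_subspaceI) (auto simp: code_poly_add code_poly_smult code_poly_zero dvd_smult)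
  have pCons: "g dvd pCons 0 p" if "g dvd p" for p
    using dvd_mult[OF that, of "[:0, 1:]"] by simp
  have "cyclic_shift c \<in> carrier_vec N" if "c \<in> carrier_vec N" for c :: "'a vec"
    using that by (simp add: cyclic_shift_def)
  moreover have "g dvd code_poly (cyclic_shift c)" if "c \<in> carrier_vec N" "g dvd code_poly c" for c
    using that assms pCons by (subst code_poly_cyclic_shift[of c N]) (auto intro: dvd_diff dvd_smult)
  ultimately show "\<forall>c\<in>{c \<in> carrier_vec N. g dvd code_poly c}.
      cyclic_shift c \<in> {c \<in> carrier_vec N. g dvd code_poly c}"
    by simp
qed

lemma generator_poly_ideal_code:
  assumes "g dvd monom 1 N - 1" "monic g" "degree g \<le> N"
  shows "generator_poly N (ideal_code N g) g"
  unfolding generator_poly_def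
proof (intro conjI allI impI)
  fix g' assume g': "monic g' \<and> ideal_code N g' = ideal_code N g"
  show "degree g \<le> degree g'"
  \<comment> \<open>A competitor of degree below \<open>N\<close> is itself a word of the code,
    hence a multiple of \<open>g\<close>; one of larger degree is no threat because
    \<open>degree g \<le> N\<close>.\<close>
  proof (cases "degree g' < N")
    case True
    then have eq: "code_poly (vec N (coeff g')) = g'"
      by (simp add: code_poly_vec_coeff)
    then have "vec N (coeff g') \<in> ideal_code N g'"
      unfolding ideal_code_def by (auto intro!: exI[of _ 1])
    then have "g dvd g'"
      using g' eq by (simp add: ideal_code_eq_multiples[OF assms(1)])
    then show ?thesis using g' by (intro dvd_imp_degree_le) auto
  qed (use assms(3) in simp)
qed (use assms in simp_all)

text \<open>Multiplication by \<open>g\<close> maps the words of length \<open>N - degree g\<close>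
  bijectively onto the code.\<close>

lemma card_ideal_code:
  fixes g :: "'a::{field_gcd,finite} poly"
  assumes "g dvd monom 1 N - 1" "g \<noteq> 0" "degree g \<le> N"
  shows "card (ideal_code N g) = CARD('a) ^ (N - degree g)"
proof -
  let ?V = "carrier_vec (N - degree g) :: 'a vec set"
  let ?f = "\<lambda>v. vec N (coeff (g * code_poly v))"
  have deg: "g * code_poly v = 0 \<or> degree (g * code_poly v) < N" if "v \<in> ?V" for v
    using code_poly_degree[of v] that assms(2)
    by (cases "code_poly v = 0") (simp_all add: degree_mult_eq)
  have "bij_betw ?f ?V (ideal_code N g)"
    unfolding bij_betw_def
  proof
    show "inj_on ?f ?V"
    proof (rule inj_onI)
      fix v w assume vw: "v \<in> ?V" "w \<in> ?V" "?f v = ?f w"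
      then have "g * code_poly v = g * code_poly w"
        using deg code_poly_vec_coeff by metis
      then show "v = w" using vw code_poly_inj assms(2) by (metis mult_cancel_left)
    qed
    show "?f ` ?V = ideal_code N g"
    proof (intro subset_antisym subsetI)
      fix c assume "c \<in> ?f ` ?V"
      then show "c \<in> ideal_code N g"
        using deg by (auto simp: ideal_code_eq_multiples[OF assms(1)] code_poly_vec_coeff)
    next
      fix c assume "c \<in> ideal_code N g"
      then obtain q where c: "c \<in> carrier_vec N" and q: "code_poly c = g * q"
        by (auto simp: ideal_code_eq_multiples[OF assms(1)] dvd_def)
      have "q = 0 \<or> degree q < N - degree g"
        using code_poly_degree[of c] c q assms(2)
        by (cases "q = 0") (simp_all add: degree_mult_eq)
      then have "code_poly (vec (N - degree g) (coeff q)) = q"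
        by (rule code_poly_vec_coeff)
      moreover have "c = vec N (coeff (g * q))"
        using c by (intro eq_vecI) (simp_all add: coeff_code_poly flip: q)
      ultimately show "c \<in> ?f ` ?V"
        by (intro image_eqI[where x = "vec (N - degree g) (coeff q)"]) simp_all
    qed
  qed
  then show ?thesis
    by (metis bij_betw_same_card card_carrier_vec)
qed

section \<open>Minimum distance and sphere packing\<close>

lemma min_dist_le: "x \<in> C \<Longrightarrow> y \<in> C \<Longrightarrow> x \<noteq> y \<Longrightarrow> min_dist C \<le> hamming_dist x y"
  unfolding min_dist_def by (rule cInf_lower) auto

text \<open>Two distinct words \<open>u\<close>, \<open>v\<close> keep the set of distances
  nonempty; otherwise \<open>Inf\<close> would default to 0.\<close>

lemma min_dist_ge:
  assumes "u \<in> C" "v \<in> C" "u \<noteq> v"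
    and "\<And>x y. x \<in> C \<Longrightarrow> y \<in> C \<Longrightarrow> x \<noteq> y \<Longrightarrow> d \<le> hamming_dist x y"
  shows "d \<le> min_dist C"
  unfolding min_dist_def by (rule cInf_greatest) (use assms in blast)+

text \<open>Only the sphere of radius two around each word is counted, not the whole ball.\<close>

lemma sphere_packing_two:
  fixes C :: "'a::{field,finite} vec set"
  assumes C: "C \<subseteq> carrier_vec N"
    and dist: "\<And>x y. x \<in> C \<Longrightarrow> y \<in> C \<Longrightarrow> x \<noteq> y \<Longrightarrow> 5 \<le> hamming_dist x y"
  shows "card C * ((\<Sum>j<N. j) * (CARD('a) - 1)\<^sup>2) \<le> CARD('a) ^ N"
proof -
  \<comment> \<open>The error word with \<open>a\<close> at position \<open>j\<close> and
    \<open>b\<close> at position \<open>i\<close>. Requiring \<open>i < j\<close> in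
    \<open>E\<close> and nonzero values in \<open>A\<close> makes each word of weight two occur
    exactly once.\<close>
  define err :: "nat \<times> nat \<Rightarrow> 'a \<times> 'a \<Rightarrow> 'a vec" where
    "err = (\<lambda>(j, i) (a, b). vec N (\<lambda>k. if k = j then a else if k = i then b else 0))"
  define E where "E = (SIGMA j:{..<N}. {..<j})"
  define A where "A = (UNIV - {0::'a}) \<times> (UNIV - {0::'a})"
  have inj: "inj_on (\<lambda>(c, p, a). c + err p a) (C \<times> E \<times> A)"
  proof (rule inj_onI)
    fix x y assume xy: "x \<in> C \<times> E \<times> A" "y \<in> C \<times> E \<times> A"
      and f: "(\<lambda>(c, p, a). c + err p a) x = (\<lambda>(c, p, a). c + err p a) y"
    obtain c j i a b where x: "x = (c, (j, i), (a, b))" by (metis surj_pair)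
    obtain c' j' i' a' b' where y: "y = (c', (j', i'), (a', b'))" by (metis surj_pair)
    have mem: "c \<in> C" "c' \<in> C" "(j, i) \<in> E" "(j', i') \<in> E" "(a, b) \<in> A" "(a', b') \<in> A"
      using xy by (auto simp: x y)
    have eq: "c + err (j, i) (a, b) = c' + err (j', i') (a', b')"
      using f by (simp add: x y)
    have dims: "dim_vec c = N" "dim_vec c' = N" using mem C by auto
    have eqk: "c $ k + (if k = j then a else if k = i then b else 0)
        = c' $ k + (if k = j' then a' else if k = i' then b' else 0)" if "k < N" for k
      using arg_cong[OF eq, of "\<lambda>v. v $ k"] that dims by (simp add: err_def)
    \<comment> \<open>Two centres sharing a sphere point differ only at the four error positions,
      which is too few for distance 5.\<close>
    have "{k. k < dim_vec c \<and> c $ k \<noteq> c' $ k} \<subseteq> {i, j, i', j'}"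
      using eqk dims by (auto split: if_splits) (metis add.right_neutral)+
    then have "hamming_dist c c' \<le> card {i, j, i', j'}"
      unfolding hamming_dist_def by (intro card_mono) auto
    also have "\<dots> \<le> 4" by (simp add: card_insert_if)
    finally have c: "c = c'" using dist[of c c'] mem by fastforce
    have ij: "i < j" "j < N" "i' < j'" "j' < N" using mem by (auto simp: E_def)
    have nz: "a \<noteq> 0" "b \<noteq> 0" "a' \<noteq> 0" "b' \<noteq> 0" using mem by (auto simp: A_def)
    have err: "(if k = j then a else if k = i then b else 0)
        = (if k = j' then a' else if k = i' then b' else 0)" if "k < N" for k
      using eqk[OF that] c by simp
    have "j = j'" "i = i'"
      using err[of i] err[of j] err[of i'] err[of j'] ij nz by (auto split: if_splits)
    moreover from this have "a = a'" "b = b'"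
      using err[of i] err[of j] ij by auto
    ultimately show "x = y"
      using c by (simp add: x y)
  qed
  have "card (C \<times> E \<times> A) \<le> card (carrier_vec N :: 'a vec set)"
    by (rule card_inj_on_le[OF inj]) (use C in \<open>auto simp: err_def\<close>)
  moreover have "card E = (\<Sum>j<N. j)"
    by (simp add: E_def)
  moreover have "card A = (CARD('a) - 1)\<^sup>2"
    by (simp add: A_def card_Diff_singleton power2_eq_square card_cartesian_product)
  ultimately show ?thesis
    by (simp add: card_cartesian_product card_carrier_vec)
qed

section \<open>Minimal polynomials over the field with three elements\<close>

locale ternary_field =
  fixes m :: nat and \<alpha> :: "'f::field"
  assumes m_pos: "m > 0"
    and card_field: "CARD('f) = 3 ^ m"
    and generator: "generates_units \<alpha>"
begin

section \<open>Characteristic, Frobenius powers and the unit group\<close>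

lemma finite_UNIV_field: "finite (UNIV :: 'f set)"
  using card_field card.infinite by fastforce

lemma CHAR_3: "CHAR('f) = 3"
proof -
  have "CHAR('f) dvd 3 ^ m"
    using CHAR_dvd_CARD[where 'a = 'f] card_field by simp
  moreover from this have "CHAR('f) > 0"
    by (metis dvd_0_left_iff gr0I power_not_zero zero_neq_numeral)
  then have "prime CHAR('f)"
    by (rule prime_CHAR_semidom)
  \<comment> \<open>The class instance of the index type \<open>three\<close> supplies the primality
    of 3.\<close>
  ultimately show ?thesis
    using prime_card[where 'a = three] by (metis card_three prime_dvd_power primes_dvd_imp_eq)
qed

lemma three_eq_0: "(3::'f) = 0"
  using of_nat_CHAR[where 'a = 'f] by (simp add: CHAR_3)

lemma cube_add: "(x + y) ^ 3 = x ^ 3 + (y::'f) ^ 3"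
proof -
  have "(x + y) ^ 3 = x ^ 3 + y ^ 3 + 3 * (x * x * y + x * y * y)"
    by Groebner_Basis.algebra
  then show ?thesis by (simp add: three_eq_0)
qed

lemma power_3_Suc: "x ^ (3 ^ Suc k) = ((x::'f) ^ (3 ^ k)) ^ 3"
  by (simp add: mult.commute flip: power_mult)

lemma frobenius_add: "(x + y) ^ (3 ^ k) = x ^ (3 ^ k) + (y::'f) ^ (3 ^ k)"
proof (induction k)
  case (Suc k)
  then show ?case
    by (simp only: power_3_Suc cube_add)
qed simp

lemma frobenius_inj: "x ^ (3 ^ k) = y ^ (3 ^ k) \<Longrightarrow> x = (y::'f)"
proof -
  assume "x ^ (3 ^ k) = y ^ (3 ^ k)"
  then have "(x - y) ^ (3 ^ k) = 0"
    using frobenius_add[of "x - y" y k] by simp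
  then show "x = y" by simp
qed

definition n :: nat where "n = 3 ^ m - 1"

lemma n_pos: "n > 0"
  using m_pos one_less_power[of "3::nat" m] by (simp add: n_def)

lemma Suc_n: "Suc n = 3 ^ m"
  by (simp add: n_def)

text \<open>Multiplication by \<open>x\<close> permutes the units, so their product is unchanged
  when multiplied by \<open>x ^ n\<close>.\<close>

lemma power_n: "x ^ n = 1" if "x \<noteq> 0" for x :: 'f
proof -
  let ?U = "- {0::'f}"
  have "bij_betw ((*) x) ?U ?U"
    by (rule bij_betwI[where g = "(*) (inverse x)"]) (use that in auto)
  then have "(\<Prod>y\<in>?U. x * y) = \<Prod>?U"
    using prod.reindex_bij_betw[of "(*) x" ?U ?U "\<lambda>y. y"] by simp
  moreover have "card ?U = n"
    by (simp add: Compl_eq_Diff_UNIV card_Diff_singleton finite_UNIV_field card_field n_def)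
  ultimately have "x ^ n * \<Prod>?U = \<Prod>?U"
    by (simp add: prod.distrib)
  moreover have "\<Prod>?U \<noteq> 0"
    using finite_UNIV_field finite_subset by (subst prod_zero_iff) auto
  ultimately show ?thesis by simp
qed

lemma power_card: "x ^ (3 ^ m) = (x::'f)"
proof (cases "x = 0")
  case False
  then show ?thesis by (simp add: power_n flip: Suc_n)
qed simp

lemma alpha_nonzero: "\<alpha> \<noteq> 0"
  using generator unfolding generates_units_def
  by (metis ComplD insertI1 power_one_right rangeI)

text \<open>Exponents may be reduced modulo \<open>n\<close>, so the first \<open>n\<close> powers
  already cover all \<open>n\<close> units and cannot repeat.\<close>

lemma alpha_power_inj: "inj_on (\<lambda>k. \<alpha> ^ k) {..<n}"
proof (rule eq_card_imp_inj_on)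
  have "\<alpha> ^ k = \<alpha> ^ (k mod n)" for k
  proof -
    have "\<alpha> ^ k = \<alpha> ^ (n * (k div n) + k mod n)"
      by (simp only: mult_div_mod_eq)
    also have "\<dots> = \<alpha> ^ (k mod n)"
      by (simp only: power_add power_mult power_n[OF alpha_nonzero] power_one mult_1)
    finally show ?thesis .
  qed
  then have "range (\<lambda>k. \<alpha> ^ k) = (\<lambda>k. \<alpha> ^ k) ` {..<n}"
    using n_pos by (metis (no_types, lifting) image_subsetI subset_antisym subset_UNIV image_mono lessThan_iff mod_less_divisor imageI)
  then have "card ((\<lambda>k. \<alpha> ^ k) ` {..<n}) = card (- {0::'f})"
    using generator by (simp add: generates_units_def)
  then show "card ((\<lambda>k. \<alpha> ^ k) ` {..<n}) = card {..<n}"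
    by (simp add: Compl_eq_Diff_UNIV card_Diff_singleton finite_UNIV_field card_field n_def)
qed simp

lemma alpha_power_eqD: "\<alpha> ^ i = \<alpha> ^ j \<Longrightarrow> i < n \<Longrightarrow> j < n \<Longrightarrow> i = j"
  using alpha_power_inj by (auto simp: inj_on_def)

section \<open>Evaluating ternary polynomials in the field\<close>

sublocale embed: comm_ring_hom "embed_F3 :: F3 \<Rightarrow> 'f"
proof
  fix a b :: F3
  \<comment> \<open>Representatives are added and multiplied modulo 3, a reduction that
    \<open>of_int\<close> does not see in characteristic 3.\<close>
  have of_int_mod: "of_int (i mod 3) = (of_int i :: 'f)" for i
    using of_int_mod_CHAR[where 'a = 'f, of i] by (simp add: CHAR_3)
  show "embed_F3 (a + b) = (embed_F3 a + embed_F3 b :: 'f)"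
    by (simp add: embed_F3_def to_int_mod_ring_add card_three of_int_mod)
  show "embed_F3 (a * b) = (embed_F3 a * embed_F3 b :: 'f)"
    by (simp add: embed_F3_def to_int_mod_ring_mult card_three of_int_mod)
qed (simp_all add: embed_F3_def)

sublocale embed_poly: map_poly_comm_ring_hom "embed_F3 :: F3 \<Rightarrow> 'f" ..

lemma F3_cases: "c = 0 \<or> c = 1 \<or> c = -1" for c :: F3
proof -
  obtain i where i: "i < CARD(three)" "c = of_nat i"
    using surj_of_nat_mod_ring by blast
  have "(3::F3) = 0" using of_nat_card_eq_0[where 'a = three] by (simp add: card_three)
  then have "(2::F3) = -1" by (simp add: eq_neg_iff_add_eq_0)
  moreover have "i = 0 \<or> i = 1 \<or> i = 2" using i(1) by (auto simp: card_three)
  ultimately show ?thesis using i(2) by auto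
qed

lemma embed_F3_nonzero: "c \<noteq> 0 \<Longrightarrow> embed_F3 c \<in> {1, -1 :: 'f}"
  using F3_cases[of c] embed.hom_uminus[of 1] by auto

lemma embed_F3_cube: "embed_F3 c ^ 3 = (embed_F3 c :: 'f)"
  using embed_F3_nonzero[of c] by (cases "c = 0") auto

definition ev :: "F3 poly \<Rightarrow> 'f \<Rightarrow> 'f" where
  "ev p x = poly (map_poly embed_F3 p) x"

lemma ev_simps [simp]:
  "ev 0 x = 0" "ev 1 x = 1" "ev (p + q) x = ev p x + ev q x"
  "ev (p - q) x = ev p x - ev q x" "ev (p * q) x = ev p x * ev q x"
  "ev (smult c p) x = embed_F3 c * ev p x" "ev (monom c k) x = embed_F3 c * x ^ k"
  "ev (pCons c p) x = embed_F3 c + x * ev p x"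
  by (simp_all add: ev_def hom_distribs poly_monom)

text \<open>The coefficients lie in the prime field and are fixed by cubing; hence Frobenius carries
  roots to roots.\<close>

lemma ev_cube: "ev p (x ^ 3) = ev p x ^ 3"
  by (induction p) (simp_all add: cube_add embed_F3_cube power_mult_distrib)

lemma ev_frobenius: "ev p (x ^ (3 ^ k)) = ev p x ^ (3 ^ k)"
proof (induction k)
  case (Suc k)
  then show ?case
    by (simp only: power_3_Suc ev_cube)
qed simp

section \<open>Minimal polynomials: existence, divisibility, degree\<close>

lemma min_poly_unique:
  assumes "is_min_poly_F3 (x::'f) p" "is_min_poly_F3 x q"
  shows "p = q"
proof (rule ccontr)
  assume "p \<noteq> q"
  have nz: "p \<noteq> 0" "q \<noteq> 0" using assms by (auto simp: is_min_poly_F3_def)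
  have deg: "degree p = degree q"
    using assms nz by (simp add: is_min_poly_F3_def order_antisym)
  have "degree (p - q) \<le> degree p"
    using degree_diff_le[of p "degree p" q] deg by simp
  moreover have "coeff (p - q) (degree p) = 0"
    using assms deg by (simp add: is_min_poly_F3_def)
  ultimately have "degree (p - q) < degree p"
    using \<open>p \<noteq> q\<close> by (metis le_neq_implies_less leading_coeff_0_iff right_minus_eq)
  moreover have "ev (p - q) x = 0"
    using assms by (simp add: is_min_poly_F3_def flip: ev_def)
  then have "degree p \<le> degree (p - q)"
    using assms(1) \<open>p \<noteq> q\<close> by (simp add: is_min_poly_F3_def ev_def)
  ultimately show False by simp
qed

text \<open>\<open>X^(3^m) - X\<close> vanishes on the whole field, so nonzero polynomials vanishing
  at \<open>x\<close> exist; one of least degree is made monic.\<close>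

lemma min_poly_exists: "\<exists>p. is_min_poly_F3 (x::'f) p"
proof -
  define A where "A = {q. q \<noteq> 0 \<and> ev q x = 0}"
  have "coeff (monom 1 (3 ^ m) - monom 1 1 :: F3 poly) (3 ^ m) = 1"
    using n_pos by (simp flip: Suc_n)
  then have "monom 1 (3 ^ m) - monom 1 1 \<in> A"
    using power_card[of x] unfolding A_def by (auto simp del: coeff_diff)
  then obtain q where q: "q \<in> A" "\<And>p. p \<in> A \<Longrightarrow> degree q \<le> degree p"
    using ex_has_least_nat[of "\<lambda>p. p \<in> A" _ degree] by blast
  define p where "p = smult (inverse (lead_coeff q)) q"
  have "is_min_poly_F3 x p"
    using q unfolding is_min_poly_F3_def p_def A_def by (auto simp flip: ev_def)
  then show ?thesis ..
qed

lemma is_min_poly: "is_min_poly_F3 (x::'f) (min_poly_F3 x)"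
  unfolding min_poly_F3_def
  using min_poly_exists min_poly_unique by (metis theI)

lemma min_poly_monic: "monic (min_poly_F3 (x::'f))"
  using is_min_poly[of x] by (simp add: is_min_poly_F3_def)

lemma min_poly_root: "ev (min_poly_F3 x) x = 0"
  using is_min_poly[of x] by (simp add: is_min_poly_F3_def ev_def)

lemma min_poly_degree_le: "q \<noteq> 0 \<Longrightarrow> ev q x = 0 \<Longrightarrow> degree (min_poly_F3 x) \<le> degree q"
  using is_min_poly[of x] by (simp add: is_min_poly_F3_def ev_def)

text \<open>The remainder of \<open>f\<close> modulo the minimal polynomial vanishes at
  \<open>x\<close> whenever \<open>f\<close> does, and minimality forces it to be zero.\<close>

lemma min_poly_dvd_iff: "min_poly_F3 x dvd f \<longleftrightarrow> ev f x = 0"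
proof
  assume "min_poly_F3 x dvd f"
  then show "ev f x = 0" by (auto simp: dvd_def min_poly_root)
next
  assume f: "ev f x = 0"
  let ?p = "min_poly_F3 x"
  have "?p \<noteq> 0" using min_poly_monic[of x] by auto
  have "ev (f mod ?p) x = ev (f - (f div ?p) * ?p) x"
    by (simp add: minus_div_mult_eq_mod)
  also have "\<dots> = 0" by (simp add: f min_poly_root)
  finally have "ev (f mod ?p) x = 0" .
  then have "f mod ?p = 0"
    using min_poly_degree_le[of "f mod ?p" x] degree_mod_less'[OF \<open>?p \<noteq> 0\<close>, of f]
    by (metis leD)
  then show "?p dvd f" by (simp add: mod_eq_0_iff_dvd)
qed

text \<open>Pigeonhole: there are more polynomials of degree at most \<open>m\<close> than possible values at \<open>x\<close>.\<close>

lemma min_poly_degree_upper: "degree (min_poly_F3 (x::'f)) \<le> m"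
proof -
  let ?V = "carrier_vec (Suc m) :: F3 vec set"
  have "\<not> inj_on (\<lambda>v. ev (code_poly v) x) ?V"
  proof
    assume "inj_on (\<lambda>v. ev (code_poly v) x) ?V"
    then have "card ?V \<le> CARD('f)"
      by (rule card_inj_on_le) (simp_all add: finite_UNIV_field)
    then show False by (simp add: card_carrier_vec card_three card_field)
  qed
  then obtain v w where vw: "v \<in> ?V" "w \<in> ?V" "v \<noteq> w" "ev (code_poly v) x = ev (code_poly w) x"
    by (auto simp: inj_on_def)
  let ?p = "code_poly v - code_poly w"
  have "code_poly v \<noteq> code_poly w"
    using inj_onD[OF inj_Poly_list_of_vec, of v w] vw by (auto simp: code_poly_def)
  moreover have "degree ?p \<le> m"
    using vw(1,2) by (intro degree_le) (simp add: coeff_code_poly)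
  ultimately show ?thesis
    using min_poly_degree_le[of ?p x] vw(4) by simp
qed

text \<open>Under the hypothesis the \<open>m\<close> conjugates \<open>x ^ (3 ^ k)\<close> are
  distinct roots of the minimal polynomial.\<close>

lemma min_poly_degree_eq:
  assumes "\<And>k. 0 < k \<Longrightarrow> k < m \<Longrightarrow> x ^ (3 ^ k) \<noteq> (x::'f)"
  shows "degree (min_poly_F3 x) = m"
proof -
  have neq: "x ^ (3 ^ i) \<noteq> x ^ (3 ^ j)" if "i < j" "j < m" for i j
  proof
    assume "x ^ (3 ^ i) = x ^ (3 ^ j)"
    also have "(3::nat) ^ j = 3 ^ (j - i) * 3 ^ i"
      using that by (simp flip: power_add)
    finally have "x = x ^ (3 ^ (j - i))"
      using frobenius_inj[of x i "x ^ (3 ^ (j - i))"] by (simp add: power_mult)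
    then show False using assms[of "j - i"] that by (metis zero_less_diff less_imp_diff_less)
  qed
  have inj: "inj_on (\<lambda>k. x ^ (3 ^ k)) {..<m}"
    by (rule linorder_inj_onI) (use neq in auto)
  let ?p = "map_poly embed_F3 (min_poly_F3 x) :: 'f poly"
  have "coeff ?p (degree (min_poly_F3 x)) = 1"
    using min_poly_monic[of x] by (simp add: coeff_map_poly)
  then have "?p \<noteq> 0" by (metis coeff_0 zero_neq_one)
  have "(\<lambda>k. x ^ (3 ^ k)) ` {..<m} \<subseteq> {y. poly ?p y = 0}"
    using min_poly_root[of x] ev_frobenius[of "min_poly_F3 x" x] by (auto simp: ev_def)
  then have "card ((\<lambda>k. x ^ (3 ^ k)) ` {..<m}) \<le> card {y. poly ?p y = 0}"
    by (intro card_mono poly_roots_finite \<open>?p \<noteq> 0\<close>)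
  also have "\<dots> \<le> degree ?p"
    by (rule card_poly_roots_bound[OF \<open>?p \<noteq> 0\<close>])
  also have "\<dots> \<le> degree (min_poly_F3 x)"
    by (rule degree_map_poly_le)
  finally show ?thesis
    using min_poly_degree_upper[of x] by (simp add: card_image[OF inj])
qed

end

section \<open>The code with zeros 2 and e\<close>

locale ternary_field_code = ternary_field m \<alpha> for m and \<alpha> :: "'f::field" +
  fixes h e :: nat
  assumes m_mod: "m mod 4 = 2" and h_def: "h = m div 2" and e_def: "e = 3 ^ h + 2"
begin

lemma m_eq: "m = 2 * h" and h_odd: "odd h" and m_ge: "m \<ge> 2"
  using m_mod by (simp_all add: h_def) presburger+

abbreviation \<sigma> :: "'f \<Rightarrow> 'f" where "\<sigma> x \<equiv> x ^ (3 ^ h)"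

lemma minus_one_neq_one: "(-1::'f) \<noteq> 1"
proof
  assume "(-1::'f) = 1"
  then have "(1::'f) + 1 = 0" by (simp add: eq_neg_iff_add_eq_0 eq_commute)
  moreover have "(1::'f) = 3 - (1 + 1)" by simp
  ultimately show False using three_eq_0 by simp
qed

text \<open>Since \<open>h\<close> is odd, \<open>3 ^ h\<close> is 3 modulo 4, so \<open>\<sigma>\<close> negates square roots of \<open>-1\<close>.\<close>

sublocale involution_char3 \<sigma>
proof
  show "(3::'f) = 0" by (rule three_eq_0)
  show "\<sigma> (x + y) = \<sigma> x + \<sigma> y" for x y by (rule frobenius_add)
  show "\<sigma> (x * y) = \<sigma> x * \<sigma> y" for x y by (rule power_mult_distrib)
  show "\<sigma> (\<sigma> x) = x" for x
    using power_card[of x] by (simp add: m_eq mult_2 power_add flip: power_mult)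
  show "\<sigma> w \<noteq> w" if w: "w ^ 2 = -1" for w
  proof -
    obtain j where j: "h = 2 * j + 1" using h_odd oddE by blast
    have "(3::nat) ^ h mod 4 = 3"
    proof -
      have "(9::nat) ^ j mod 4 = 1" using power_mod[of "9::nat" 4 j] by simp
      then have "3 * 9 ^ j mod 4 = (3::nat)" using mod_mult_right_eq[of "3::nat" "9 ^ j" 4] by simp
      then show ?thesis by (simp add: j power_mult)
    qed
    define k where "k = (3::nat) ^ h div 4"
    \<comment> \<open>Writing \<open>4 * k + 3\<close> this way shows \<open>\<sigma> w\<close> as
      \<open>w\<close> times an odd power of \<open>w^2 = -1\<close>.\<close>
    have k: "(3::nat) ^ h = 2 * (2 * k + 1) + 1"
      using \<open>3 ^ h mod 4 = 3\<close> mult_div_mod_eq[of 4 "(3::nat) ^ h"] by (simp add: k_def)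
    have "\<sigma> w = w * (w ^ 2) ^ (2 * k + 1)" unfolding k by (simp only: power_mult power_add power_one_right mult.commute)
    also have "\<dots> = - w" by (simp add: w)
    finally have "\<sigma> w = - w" .
    moreover have "- w \<noteq> w"
    proof
      assume "- w = w"
      then have "w * (-1) = w * 1" by simp
      moreover have "w \<noteq> 0" using w by auto
      ultimately show False using minus_one_neq_one by (metis mult_cancel_left)
    qed
    ultimately show ?thesis by simp
  qed
qed

lemma power_e: "x ^ e = \<sigma> x * x\<^sup>2" for x :: 'f
  by (simp only: e_def power_add)

text \<open>Multiplying by the conjugate relation gives
  \<open>x^3 = x^4 * (\<sigma> x)^2 = (x ^ e)^2 = 1\<close>, and cubing is injective. So conjugates
  of \<open>\<alpha> ^ e\<close> coincide only if those of \<open>\<alpha>\<close> do.\<close>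

lemma power_e_eq_1: "x ^ e = 1 \<Longrightarrow> x = (1::'f)"
proof -
  assume "x ^ e = 1"
  then have 1: "\<sigma> x * x\<^sup>2 = 1" by (simp add: power_e)
  then have 2: "x * (\<sigma> x)\<^sup>2 = 1"
    by (metis sigma_1 sigma_mult sigma_power sigma_sigma)
  have "x ^ 3 = x ^ 3 * (x * (\<sigma> x)\<^sup>2)" using 2 by simp
  also have "\<dots> = (\<sigma> x * x\<^sup>2)\<^sup>2" by (simp add: power_numeral_reduce ac_simps)
  also have "\<dots> = 1" using 1 by simp
  finally have "x ^ (3 ^ 1) = 1 ^ (3 ^ 1)" by simp
  then show "x = 1" by (rule frobenius_inj)
qed

text \<open>Keeps the exponents met below in the range where powers of \<open>\<alpha>\<close> are
  distinct. Here \<open>2 * 3 ^ (m - 1) = n + 1 - 3 ^ (m - 1)\<close>, and \<open>m \<ge> 2\<close>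
  makes the subtracted power at least 3.\<close>

lemma three_power_lt: "k < m \<Longrightarrow> 2 * 3 ^ k < n"
proof -
  assume "k < m"
  then have "(3::nat) ^ k \<le> 3 ^ (m - 1)" by (intro power_increasing) auto
  moreover have "(3::nat) ^ m = 3 * 3 ^ (m - 1)" using m_pos by (simp flip: power_Suc)
  moreover have "(3::nat) \<le> 3 ^ (m - 1)" using power_increasing[of 1 "m - 1" "3::nat"] m_ge by simp
  ultimately show ?thesis using Suc_n by linarith
qed

section \<open>Degrees and distinctness of the two minimal polynomials\<close>

abbreviation p2 :: "F3 poly" where "p2 \<equiv> min_poly_F3 (\<alpha>\<^sup>2)"
abbreviation pe :: "F3 poly" where "pe \<equiv> min_poly_F3 (\<alpha> ^ e)"

lemma degree_p2: "degree p2 = m"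
proof (rule min_poly_degree_eq)
  fix k assume k: "0 < k" "k < m"
  show "(\<alpha>\<^sup>2) ^ (3 ^ k) \<noteq> \<alpha>\<^sup>2"
  proof
    assume "(\<alpha>\<^sup>2) ^ (3 ^ k) = \<alpha>\<^sup>2"
    \<comment> \<open>The factor \<open>3 ^ 0\<close> lets \<open>three_power_lt\<close> bound both
      exponents.\<close>
    then have "\<alpha> ^ (2 * 3 ^ k) = \<alpha> ^ (2 * 3 ^ 0)" by (simp add: power_mult)
    then have "2 * 3 ^ k = (2 * 3 ^ 0 :: nat)"
      by (rule alpha_power_eqD) (use three_power_lt k in \<open>blast+\<close>)
    then show False using k by simp
  qed
qed

lemma degree_pe: "degree pe = m"
proof (rule min_poly_degree_eq)
  fix k assume k: "0 < k" "k < m"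
  show "(\<alpha> ^ e) ^ (3 ^ k) \<noteq> \<alpha> ^ e"
  proof
    assume "(\<alpha> ^ e) ^ (3 ^ k) = \<alpha> ^ e"
    then have "(\<alpha> ^ (3 ^ k)) ^ e = \<alpha> ^ e"
      by (simp add: mult.commute flip: power_mult)
    then have "(\<alpha> ^ (3 ^ k) / \<alpha>) ^ e = 1"
      using alpha_nonzero by (simp add: power_divide)
    then have "\<alpha> ^ (3 ^ k) / \<alpha> = 1" by (rule power_e_eq_1)
    then have "\<alpha> ^ (3 ^ k) = \<alpha> ^ (3 ^ 0)" using alpha_nonzero by simp
    then have "3 ^ k = (3 ^ 0 :: nat)"
      by (rule alpha_power_eqD) (use three_power_lt[of k] three_power_lt[of 0] k in simp_all)
    then show False using k by simp
  qed
qed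

text \<open>\<open>\<alpha>\<^sup>2\<close> is a root of \<open>x ^ (n div 2) - 1\<close>, whereas \<open>\<alpha> ^ e\<close> is not because \<open>e\<close> is odd.\<close>

lemma pe_not_root: "ev p2 (\<alpha> ^ e) \<noteq> 0"
proof
  assume root: "ev p2 (\<alpha> ^ e) = 0"
  have "odd (Suc n)" by (simp add: Suc_n)
  then have n2: "2 * (n div 2) = n" by simp
  let ?f = "monom 1 (n div 2) - 1 :: F3 poly"
  have "(\<alpha>\<^sup>2) ^ (n div 2) = 1"
    using power_n[OF alpha_nonzero] n2 by (metis power_mult)
  then have "p2 dvd ?f" by (simp add: min_poly_dvd_iff)
  then have "ev ?f (\<alpha> ^ e) = 0" using root by (metis dvdE ev_simps(5) mult_zero_left)
  then have "\<alpha> ^ (e * (n div 2)) = 1" by (simp add: power_mult)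
  \<comment> \<open>With \<open>e = 2 * c + 1\<close> the exponent \<open>e * (n div 2)\<close> is
    \<open>n div 2\<close> modulo \<open>n\<close>, strictly between 0 and \<open>n\<close>.\<close>
  moreover obtain c where "e = 2 * c + 1"
    using oddE[of e] by (auto simp: e_def)
  then have "e * (n div 2) = 2 * (n div 2) * c + n div 2" by simp
  then have "e * (n div 2) = n * c + n div 2" by (simp only: n2)
  ultimately have "\<alpha> ^ (n div 2) = \<alpha> ^ 0"
    by (simp add: power_add power_mult power_n[OF alpha_nonzero])
  then have "n div 2 = 0" by (rule alpha_power_eqD) (use n_pos in auto)
  then show False using n2 n_pos by simp
qed

section \<open>The generator polynomial and the dimension\<close>

abbreviation g :: "F3 poly" where "g \<equiv> min_poly_product \<alpha> [2, int e]"
abbreviation code :: "F3 vec set" where "code \<equiv> ternary_cyclic_code m \<alpha> [2, int e]"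

lemma g_eq: "g = p2 * pe"
  by (simp add: min_poly_product_def)

lemma g_monic: "monic g"
  by (simp add: g_eq lead_coeff_mult min_poly_monic)

lemma g_nonzero: "g \<noteq> 0"
  using g_monic by auto

lemma degree_g: "degree g = 2 * m"
  using min_poly_monic[of "\<alpha>\<^sup>2"] min_poly_monic[of "\<alpha> ^ e"]
  by (subst g_eq, subst degree_mult_eq) (auto simp: degree_p2 degree_pe)

text \<open>After dividing \<open>f\<close> by \<open>p2\<close>, the cofactor must vanish at
  \<open>\<alpha> ^ e\<close> because \<open>p2\<close> does not, so \<open>pe\<close> divides
  it.\<close>

lemma g_dvd_iff: "g dvd f \<longleftrightarrow> ev f (\<alpha>\<^sup>2) = 0 \<and> ev f (\<alpha> ^ e) = 0"
proof
  assume "g dvd f"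
  then show "ev f (\<alpha>\<^sup>2) = 0 \<and> ev f (\<alpha> ^ e) = 0"
    by (auto simp: g_eq dvd_def min_poly_root)
next
  assume f: "ev f (\<alpha>\<^sup>2) = 0 \<and> ev f (\<alpha> ^ e) = 0"
  then obtain q where q: "f = p2 * q" by (auto simp: dvd_def simp flip: min_poly_dvd_iff)
  then have "ev q (\<alpha> ^ e) = 0" using f pe_not_root by simp
  then have "pe dvd q" by (simp add: min_poly_dvd_iff)
  then show "g dvd f" by (simp add: g_eq q)
qed

lemma g_dvd: "g dvd monom 1 n - 1"
  using power_n alpha_nonzero by (simp add: g_dvd_iff)

lemma eight_le_n: "n \<ge> 8"
  using power_increasing[OF m_ge, of "3::nat"] by (simp flip: Suc_n)

text \<open>Makes the natural subtraction \<open>n - 2 * m\<close> exact and the dimension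
  positive.\<close>

lemma two_m_lt_n: "2 * m < n"
proof -
  have "2 * k + 1 < 3 ^ k" if "k \<ge> 2" for k :: nat
    using that by (induction k rule: dec_induct) auto
  then show ?thesis using m_ge by (fastforce simp flip: Suc_n)
qed

lemma code_iff: "c \<in> code \<longleftrightarrow> c \<in> carrier_vec n \<and> ev (code_poly c) (\<alpha>\<^sup>2) = 0 \<and> ev (code_poly c) (\<alpha> ^ e) = 0"
  unfolding ternary_cyclic_code_def n_def[symmetric] ideal_code_eq_multiples[OF g_dvd] by (simp add: g_dvd_iff)

lemma cyclic_code_code: "cyclic_code n code"
  unfolding ternary_cyclic_code_def n_def[symmetric] by (rule cyclic_code_ideal_code[OF g_dvd n_pos])

lemma generator_poly_code: "generator_poly n code g"
  unfolding ternary_cyclic_code_def n_def[symmetric]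
  by (rule generator_poly_ideal_code[OF g_dvd g_monic]) (use two_m_lt_n in \<open>simp add: degree_g\<close>)

lemma card_code: "card code = 3 ^ (n - 2 * m)"
  unfolding ternary_cyclic_code_def n_def[symmetric]
  using card_ideal_code[OF g_dvd g_nonzero] two_m_lt_n by (simp add: degree_g card_three)

lemma linear_subspace_code: "linear_subspace n code"
  using cyclic_code_code by (simp add: cyclic_code_def)

lemma code_dim_code: "code_dim n code = n - 2 * m"
  using card_linear_code[OF linear_subspace_code] card_code by (simp add: card_three)

section \<open>Minimum distance and optimality\<close>

lemma ev_sum: "ev (\<Sum>i\<in>S. f i) x = (\<Sum>i\<in>S. ev (f i) x)"
  by (induction S rule: infinite_finite_induct) auto

text \<open>Summing over the support alone turns a word of low weight into a relation with few
  terms.\<close>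

lemma ev_code_poly: "ev (code_poly v) x = (\<Sum>i | i < dim_vec v \<and> v $ i \<noteq> 0. embed_F3 (v $ i) * x ^ i)"
proof -
  have "ev (code_poly v) x = (\<Sum>i<dim_vec v. embed_F3 (v $ i) * x ^ i)"
    by (subst code_poly_as_sum) (simp add: ev_sum)
  also have "\<dots> = (\<Sum>i | i < dim_vec v \<and> v $ i \<noteq> 0. embed_F3 (v $ i) * x ^ i)"
    by (rule sum.mono_neutral_right) auto
  finally show ?thesis .
qed

text \<open>The difference \<open>w\<close> of two words is again in the code. Its values at the two
  zeros give relations between the distinct elements \<open>\<alpha> ^ i\<close>, for
  \<open>i\<close> in its support, with coefficients 1 or -1; up to three terms these are
  impossible.\<close>

lemma hamming_dist_code:
  assumes "u \<in> code" "v \<in> code" "u \<noteq> v"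
  shows "4 \<le> hamming_dist u v"
proof (rule ccontr)
  assume "\<not> 4 \<le> hamming_dist u v"
  define w where "w = u - v"
  have dims: "dim_vec u = n" "dim_vec v = n" using assms by (auto simp: code_iff)
  define S where "S = {i. i < n \<and> w $ i \<noteq> 0}"
  define c where "c i = (embed_F3 (w $ i) :: 'f)" for i
  have S_eq: "S = {i. i < dim_vec u \<and> u $ i \<noteq> v $ i}"
    using dims by (auto simp: S_def w_def)
  have fin: "finite S" by (simp add: S_def)
  have dimw: "dim_vec w = n" using dims by (simp add: w_def)
  have "S \<noteq> {}" using assms(3) dims by (auto simp: S_eq intro: eq_vecI)
  have "card S < 4" using \<open>\<not> 4 \<le> _\<close> by (simp add: S_eq hamming_dist_def)
  moreover have "card S \<noteq> 0" using fin \<open>S \<noteq> {}\<close> by simp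
  ultimately consider "card S = 1" | "card S = 2" | "card S = 3" by linarith
  moreover have ev_w: "ev (code_poly w) (\<alpha>\<^sup>2) = 0" "ev (code_poly w) (\<alpha> ^ e) = 0"
    using assms by (auto simp: w_def code_iff code_poly_diff dims)
  have sum2: "(\<Sum>i\<in>S. c i * (\<alpha> ^ i)\<^sup>2) = 0"
    using ev_w(1) by (simp add: ev_code_poly dimw S_def c_def mult.commute flip: power_mult)
  \<comment> \<open>Exchanging exponents, \<open>(\<alpha> ^ e) ^ i = (\<alpha> ^ i) ^ e\<close>,
    brings in \<open>\<sigma>\<close>.\<close>
  have sume: "(\<Sum>i\<in>S. c i * (\<sigma> (\<alpha> ^ i) * (\<alpha> ^ i)\<^sup>2)) = 0"
    using ev_w(2) unfolding power_e[symmetric]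
    by (simp add: ev_code_poly dimw S_def c_def mult.commute flip: power_mult)
  have c: "c i \<in> {1, -1}" "c i \<noteq> 0" if "i \<in> S" for i
    using that embed_F3_nonzero[of "w $ i"] by (auto simp: S_def c_def)
  have neq: "\<alpha> ^ i \<noteq> \<alpha> ^ j" if "i \<in> S" "j \<in> S" "i \<noteq> j" for i j
    using that alpha_power_eqD[of i j] by (auto simp: S_def)
  ultimately show False
  proof cases
    case 1
    then obtain i where "S = {i}" by (auto simp: card_1_singleton_iff)
    then show False using sum2 c(2)[of i] alpha_nonzero by simp
  next
    case 2
    then obtain i j where S: "S = {i, j}" "i \<noteq> j" by (auto simp: card_2_iff)
    have expand: "(\<Sum>l\<in>S. f l) = f i + f j" for f :: "nat \<Rightarrow> 'f"
      using S(2) by (simp add: S(1))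
    have "c i \<noteq> 0" "\<alpha> ^ i \<noteq> 0" using c(2)[of i] alpha_nonzero by (simp_all add: S(1))
    then have "\<alpha> ^ i = \<alpha> ^ j"
      using sum2 sume unfolding expand by (rule two_term_relation)
    then show False using neq[of i j] S by simp
  next
    case 3
    then obtain i j k where S: "S = {i, j, k}" "i \<noteq> j" "j \<noteq> k" "i \<noteq> k" by (auto simp: card_3_iff)
    have expand: "(\<Sum>l\<in>S. f l) = f i + f j + f k" for f :: "nat \<Rightarrow> 'f"
      using S(2-4) by (simp add: S(1) add.assoc)
    have "c i \<in> {1, -1}" "c j \<in> {1, -1}" "c k \<in> {1, -1}"
      using c(1) by (simp_all only: S(1) insert_iff simp_thms)
    moreover have "\<alpha> ^ i \<noteq> 0" "\<alpha> ^ j \<noteq> 0" "\<alpha> ^ k \<noteq> 0" using alpha_nonzero by simp_all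
    ultimately have "\<alpha> ^ i = \<alpha> ^ j \<or> \<alpha> ^ j = \<alpha> ^ k \<or> \<alpha> ^ i = \<alpha> ^ k"
      using sum2 sume unfolding expand by (rule three_term_relation)
    then show False using neq[of i j] neq[of j k] neq[of i k] S by auto
  qed
qed

text \<open>Distance 5 would bound the sphere size by \<open>3 ^ n\<close> divided by the number of
  words, that is \<open>2 * n * (n - 1) \<le> 3 ^ (2 * m) = (n + 1)^2\<close>, false for
  \<open>n \<ge> 8\<close>.\<close>

lemma min_dist_le_4:
  fixes C :: "F3 vec set"
  assumes "linear_subspace n C" "code_dim n C = n - 2 * m"
  shows "min_dist C \<le> 4"
proof (rule ccontr)
  assume "\<not> min_dist C \<le> 4"
  then have "5 \<le> hamming_dist x y" if "x \<in> C" "y \<in> C" "x \<noteq> y" for x y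
    using min_dist_le[OF that] by linarith
  then have "card C * ((\<Sum>j<n. j) * (CARD(F3) - 1)\<^sup>2) \<le> CARD(F3) ^ n"
    using linear_subspace_carrier[OF assms(1)] by (intro sphere_packing_two)
  moreover have "card C = 3 ^ (n - 2 * m)"
    using card_linear_code[OF assms(1)] assms(2) by (simp add: card_three)
  moreover have "(3::nat) ^ n = 3 ^ (n - 2 * m) * 3 ^ (2 * m)"
    using two_m_lt_n by (simp flip: power_add)
  ultimately have "(\<Sum>j<n. j) * 4 \<le> 3 ^ (2 * m)"
    by (simp add: card_three)
  also have "(3::nat) ^ (2 * m) = (n + 1)\<^sup>2"
    using Suc_n by (metis Suc_eq_plus1 mult.commute power_mult)
  also have "(\<Sum>j<n. j) * 4 = 2 * (n * (n - 1))"
  proof -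
    have "2 * (\<Sum>j<N. j) = N * (N - 1)" for N :: nat
    proof (induction N)
      case (Suc N)
      then show ?case by (cases N) (simp_all add: algebra_simps)
    qed simp
    from this[of n] show ?thesis by linarith
  qed
  finally have "2 * (n * (n - 1)) \<le> (n + 1)\<^sup>2" .
  \<comment> \<open>After the shift by 8 both sides are polynomials in \<open>k\<close> that can be
    compared coefficientwise.\<close>
  moreover obtain k where k: "n = k + 8" using eight_le_n by (metis add.commute le_Suc_ex)
  ultimately show False unfolding k by (simp add: power2_eq_square algebra_simps)
qed

lemma linear_code_code: "linear_code n (n - 2 * m) 4 code"
proof -
  \<comment> \<open>Needed for \<open>min_dist_ge\<close>; the positive dimension provides more than
    one word.\<close>
  have "\<exists>u\<in>code. \<exists>v\<in>code. u \<noteq> v"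
  proof (rule ccontr)
    assume "\<not> ?thesis"
    then have "card code \<le> 1" by (metis card_le_Suc0_iff_eq card.infinite One_nat_def zero_le_one)
    moreover have "(3::nat) ^ (n - 2 * m) > 1" using two_m_lt_n by (intro one_less_power) auto
    ultimately show False by (simp add: card_code)
  qed
  then have "4 \<le> min_dist code"
    using hamming_dist_code min_dist_ge by metis
  then have "min_dist code = 4"
    using min_dist_le_4[OF linear_subspace_code code_dim_code] by simp
  then show ?thesis
    by (simp add: linear_code_def linear_subspace_code code_dim_code)
qed

lemma optimal_code_code: "optimal_code n (n - 2 * m) 4 code"
  unfolding optimal_code_def using linear_code_code min_dist_le_4
  by (auto simp: linear_code_def not_less)

end

theorem theorem3:
  fixes m h e :: nat and \<alpha> :: "'f::field"
  assumes "m > 0" and "m mod 4 = 2" and "h = m div 2" and "e = 3 ^ h + 2"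
    and "CARD('f) = 3 ^ m" and "generates_units \<alpha>"
  shows "cyclic_code (3 ^ m - 1) (ternary_cyclic_code m \<alpha> [2, int e]) \<and>
    generator_poly (3 ^ m - 1) (ternary_cyclic_code m \<alpha> [2, int e])
      (min_poly_product \<alpha> [2, int e]) \<and>
    linear_code (3 ^ m - 1) (3 ^ m - 2 * m - 1) 4 (ternary_cyclic_code m \<alpha> [2, int e]) \<and>
    optimal_code (3 ^ m - 1) (3 ^ m - 2 * m - 1) 4 (ternary_cyclic_code m \<alpha> [2, int e])"
proof -
  interpret ternary_field_code m \<alpha> h e
    by standard (use assms in simp_all)
  have "3 ^ m - 2 * m - 1 = n - 2 * m" by (simp add: n_def)
  then show ?thesis
    using cyclic_code_code generator_poly_code linear_code_code optimal_code_code
    by (simp only: n_def[symmetric])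
qed

end
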